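(* Let $\mathcal{E}\subset\mathbb{C}^{2\times2}$ be the set of $2\times 2$ complex matrices all of whose eigenvalues lie in the closed left half-plane $\{z\in\mathbb{C}:\Re z\le0\}$, and for $A\in\mathbb{R}^{2\times2}$ let $$d_{\mathbb{C}}(A)=\min_{X\in\mathcal{E}}\|A-X\|_F,\qquad d_{\mathbb{R}}(A)=\min_{X\in\mathcal{E}\cap\mathbb{R}^{2\times2}}\|A-X\|_F.$$ Then, for every $A\in\mathbb{R}^{2\times2}$, it holds $d_{\mathbb{R}}(A)=d_{\mathbb{C}}(A)$.
   Context: $\|\cdot\|_F$ is the Frobenius norm. *)

theory Defs
  imports "HOL-Analysis.Analysis"
begin

definition eigenvalue :: "complex^'n^'n \<Rightarrow> complex \<Rightarrow> bool" where
  "eigenvalue X z \<longleftrightarrow> (\<exists>v. v \<noteq> 0 \<and> X *v v = z *s v)"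

definition stable_matrices :: "(complex^2^2) set" where
  "stable_matrices = {X. \<forall>z. eigenvalue X z \<longrightarrow> Re z \<le> 0}"

abbreviation cmat :: "real^2^2 \<Rightarrow> complex^2^2" where
  "cmat \<equiv> map_matrix complex_of_real"

text \<open>The norm of the type \<^typ>\<open>complex^2^2\<close> is the Euclidean norm of the vector of Euclidean
  norms of the rows, which is the Frobenius norm.\<close>

lemma norm_eq_frobenius:
  "norm (X :: complex^2^2) = sqrt (\<Sum>i\<in>UNIV. \<Sum>j\<in>UNIV. (cmod (X $ i $ j))\<^sup>2)"
  by (simp add: norm_vec_def L2_set_def sum_nonneg)

text \<open>The distances are genuine minima, so they are taken as least elements;
  that these exist is shown in \<open>dist_stable_complex_min\<close> and \<open>dist_stable_real_min\<close> below.\<close>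

definition dist_stable_complex :: "real^2^2 \<Rightarrow> real" where
  "dist_stable_complex A = (LEAST d. \<exists>X\<in>stable_matrices. d = norm (cmat A - X))"

definition dist_stable_real :: "real^2^2 \<Rightarrow> real" where
  "dist_stable_real A = (LEAST d. \<exists>X\<in>stable_matrices \<inter> range cmat. d = norm (cmat A - X))"

lemma eigenvalue_iff_det:
  fixes X :: "complex^2^2"
  shows "eigenvalue X z \<longleftrightarrow> (z - X$1$1) * (z - X$2$2) - X$1$2 * X$2$1 = 0"
proof -
  have mv: "X *v v - z *s v = (X - mat z) *v v" for v
    by (simp add: vec_eq_iff matrix_vector_mult_def UNIV_2 mat_def forall_2 algebra_simps)
  have "eigenvalue X z \<longleftrightarrow> (\<exists>v. v \<noteq> 0 \<and> (X - mat z) *v v = 0)"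
    unfolding eigenvalue_def mv[symmetric] by simp
  also have "\<dots> \<longleftrightarrow> \<not> invertible (X - mat z)"
    unfolding invertible_left_inverse matrix_left_invertible_ker by blast
  also have "\<dots> \<longleftrightarrow> det (X - mat z) = 0"
    by (simp add: invertible_det_nz)
  also have "det (X - mat z) = (z - X$1$1) * (z - X$2$2) - X$1$2 * X$2$1"
    by (simp add: det_2 mat_def algebra_simps)
  finally show ?thesis .
qed

lemma stable_matrices_iff:
  "X \<in> stable_matrices \<longleftrightarrow>
    (\<forall>z. 0 \<le> Re z \<longrightarrow> (Re z)\<^sup>2 \<le> cmod ((z - X$1$1) * (z - X$2$2) - X$1$2 * X$2$1))"
proof
  assume X: "X \<in> stable_matrices"
  define s where "s = csqrt ((X$1$1 - X$2$2)\<^sup>2 + 4 * X$1$2 * X$2$1)"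
  define a where "a = (X$1$1 + X$2$2 + s) / 2"
  define b where "b = (X$1$1 + X$2$2 - s) / 2"
  have s2: "s * s = (X$1$1 - X$2$2)\<^sup>2 + 4 * X$1$2 * X$2$1"
    by (simp add: s_def flip: power2_eq_square)
  have fac: "(z - X$1$1) * (z - X$2$2) - X$1$2 * X$2$1 = (z - a) * (z - b)" for z
  proof -
    have "4 * ((z - a) * (z - b)) = (2*z - X$1$1 - X$2$2)\<^sup>2 - s * s"
      unfolding a_def b_def by (simp add: field_simps power2_eq_square)
    also have "\<dots> = 4 * ((z - X$1$1) * (z - X$2$2) - X$1$2 * X$2$1)"
      unfolding s2 by (simp add: algebra_simps power2_eq_square)
    finally show ?thesis
      by (metis mult_left_cancel zero_neq_numeral)
  qed
  have "eigenvalue X a" "eigenvalue X b"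
    by (simp_all add: eigenvalue_iff_det fac)
  then have ab: "Re a \<le> 0" "Re b \<le> 0"
    using X by (auto simp: stable_matrices_def)
  show "\<forall>z. 0 \<le> Re z \<longrightarrow> (Re z)\<^sup>2 \<le> cmod ((z - X$1$1) * (z - X$2$2) - X$1$2 * X$2$1)"
  proof (intro allI impI)
    fix z assume z: "0 \<le> Re z"
    have "Re z \<le> cmod (z - a)" "Re z \<le> cmod (z - b)"
      using ab complex_Re_le_cmod[of "z - a"] complex_Re_le_cmod[of "z - b"] by auto
    then show "(Re z)\<^sup>2 \<le> cmod ((z - X$1$1) * (z - X$2$2) - X$1$2 * X$2$1)"
      unfolding fac norm_mult power2_eq_square using z by (intro mult_mono) auto
  qed
next
  assume R: "\<forall>z. 0 \<le> Re z \<longrightarrow> (Re z)\<^sup>2 \<le> cmod ((z - X$1$1) * (z - X$2$2) - X$1$2 * X$2$1)"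
  show "X \<in> stable_matrices"
    unfolding stable_matrices_def
  proof (intro CollectI allI impI)
    fix z assume "eigenvalue X z"
    then have "cmod ((z - X$1$1) * (z - X$2$2) - X$1$2 * X$2$1) = 0"
      by (simp add: eigenvalue_iff_det)
    then show "Re z \<le> 0"
      using R[rule_format, of z] by (cases "0 \<le> Re z") auto
  qed
qed

lemma closed_stable_matrices: "closed stable_matrices"
proof -
  have "stable_matrices = (\<Inter>z\<in>{z. 0 \<le> Re z}.
      {X. (Re z)\<^sup>2 \<le> cmod ((z - X$1$1) * (z - X$2$2) - X$1$2 * X$2$1)})"
    using stable_matrices_iff by blast
  then show ?thesis
    by (elim ssubst) (intro closed_INT ballI closed_Collect_le continuous_intros)
qed

lemma closed_range_cmat: "closed (range cmat)"
proof -
  have "range cmat = {X. \<forall>i j. Im (X $ i $ j) = 0}"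
  proof safe
    fix X :: "complex^2^2" assume "\<forall>i j. Im (X $ i $ j) = 0"
    then have "X = cmat (map_matrix Re X)"
      by (simp add: vec_eq_iff complex_eq_iff)
    then show "X \<in> range cmat" by blast
  qed simp
  then show ?thesis
    by (elim ssubst) (intro closed_Collect_all closed_Collect_eq continuous_intros)
qed

lemma Least_norm_attained:
  fixes B :: "complex^2^2"
  assumes "closed S" "S \<noteq> {}"
  defines "m \<equiv> (LEAST d. \<exists>X\<in>S. d = norm (B - X))"
  shows "(\<exists>X\<in>S. m = norm (B - X)) \<and> (\<forall>X\<in>S. m \<le> norm (B - X))"
proof -
  obtain X where X: "X \<in> S" "\<And>Y. Y \<in> S \<Longrightarrow> norm (B - X) \<le> norm (B - Y)"
    using distance_attains_inf[OF assms(1,2), of B] by (auto simp: dist_norm)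
  have "m = norm (B - X)"
    unfolding m_def by (rule Least_equality) (use X in auto)
  then show ?thesis using X by auto
qed

lemma zero_stable: "0 \<in> stable_matrices \<inter> range cmat"
proof -
  have "0 = cmat 0" by (simp add: vec_eq_iff)
  then show ?thesis
    by (auto simp: stable_matrices_def eigenvalue_iff_det)
qed

lemma dist_stable_complex_min:
  "(\<exists>X\<in>stable_matrices. dist_stable_complex A = norm (cmat A - X)) \<and>
   (\<forall>X\<in>stable_matrices. dist_stable_complex A \<le> norm (cmat A - X))"
  unfolding dist_stable_complex_def
  by (rule Least_norm_attained) (use closed_stable_matrices zero_stable in auto)

lemma dist_stable_real_min:
  "(\<exists>X\<in>stable_matrices \<inter> range cmat. dist_stable_real A = norm (cmat A - X)) \<and>
   (\<forall>X\<in>stable_matrices \<inter> range cmat. dist_stable_real A \<le> norm (cmat A - X))"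
  unfolding dist_stable_real_def
  by (rule Least_norm_attained)
    (use closed_stable_matrices closed_range_cmat zero_stable in \<open>auto intro: closed_Int\<close>)

end

theory Submission
  imports Defs
begin

text \<open>Let \<open>X = P + i Q\<close> be stable, with \<open>P\<close> and \<open>Q\<close> real. Then \<open>tr P \<le> 0\<close>, and comparing real parts of
  the product of the eigenvalues gives \<open>- det P \<le> \<parallel>Q\<parallel>\<^sup>2 / 2\<close>. If \<open>det P \<ge> 0\<close>, then \<open>P\<close> is
  stable and at least as close to \<open>A\<close> as \<open>X\<close>. Otherwise, let \<open>J\<close> be the antisymmetric matrix with
  entries \<open>1\<close> and \<open>-1\<close>: the matrix \<open>P + t J\<close> has the trace of \<open>P\<close>, and its determinant is a monic quadratic in \<open>t\<close> with
  roots \<open>t\<^sub>2 < 0 < t\<^sub>1\<close>, \<open>t\<^sub>1 t\<^sub>2 = det P\<close>. So \<open>P\<close> is a convex combination of the stable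
  matrices \<open>P + t\<^sub>1 J\<close> and \<open>P + t\<^sub>2 J\<close> with variance \<open>- 2 t\<^sub>1 t\<^sub>2 = - 2 det P \<le> \<parallel>Q\<parallel>\<^sup>2\<close>, and one of them
  has squared distance to \<open>A\<close> at most \<open>\<parallel>A - P\<parallel>\<^sup>2 + \<parallel>Q\<parallel>\<^sup>2 = \<parallel>A - X\<parallel>\<^sup>2\<close>.\<close>

text \<open>If \<open>Re z > 0\<close>, the imaginary part of the characteristic equation forces
  \<open>Im z = 0\<close>; the real part is then a sum of nonnegative terms with
  \<open>(Re z)\<^sup>2\<close> positive.\<close>

lemma cmat_stable:
  assumes "trace B \<le> 0" "det B \<ge> 0"
  shows "cmat B \<in> stable_matrices"
  unfolding stable_matrices_def
proof (intro CollectI allI impI)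
  fix z assume "eigenvalue (cmat B) z"
  then have "(z - B$1$1) * (z - B$2$2) - B$1$2 * B$2$1 = 0"
    by (simp add: eigenvalue_iff_det)
  then have re: "(Re z)\<^sup>2 - (Im z)\<^sup>2 - trace B * Re z + det B = 0"
    and im: "Im z * (2 * Re z - trace B) = 0"
    by (auto simp: complex_eq_iff det_2 trace_def UNIV_2 power2_eq_square algebra_simps)
  show "Re z \<le> 0"
  proof (rule ccontr)
    assume "\<not> Re z \<le> 0"
    then have z: "0 < Re z" by simp
    then have "Im z = 0" using im assms(1) by auto
    moreover have "trace B * Re z \<le> 0"
      using z assms(1) by (simp add: mult_nonpos_nonneg)
    ultimately show False
      using re assms(2) zero_less_power[OF z, of 2] by simp
  qed
qed

lemma trace_det_eigenvalues:
  fixes X :: "complex^2^2"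
  obtains a b where "eigenvalue X a" "eigenvalue X b" "a + b = trace X" "a * b = det X"
proof -
  define s where "s = csqrt ((trace X)\<^sup>2 - 4 * det X)"
  define a where "a = (trace X + s) / 2"
  define b where "b = (trace X - s) / 2"
  have ab: "a + b = trace X"
    by (simp add: a_def b_def field_simps)
  have s2: "s\<^sup>2 = (trace X)\<^sup>2 - 4 * det X"
    by (simp add: s_def)
  have "a * b = ((trace X)\<^sup>2 - s\<^sup>2) / 4"
    by (simp add: a_def b_def field_simps power2_eq_square)
  then have det: "a * b = det X"
    by (simp add: s2)
  have "(z - X$1$1) * (z - X$2$2) - X$1$2 * X$2$1 = (z - a) * (z - b)" for z
  proof -
    have "(z - X$1$1) * (z - X$2$2) - X$1$2 * X$2$1 = z * z - trace X * z + det X"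
      by (simp add: det_2 trace_def UNIV_2 algebra_simps)
    also have "\<dots> = (z - a) * (z - b)"
      unfolding ab[symmetric] det[symmetric] by (simp add: algebra_simps)
    finally show ?thesis .
  qed
  then have "eigenvalue X a" "eigenvalue X b"
    by (simp_all add: eigenvalue_iff_det)
  then show thesis using that ab det by blast
qed

lemma trace_Re_nonpos_if_stable:
  assumes "X \<in> stable_matrices"
  shows "trace (map_matrix Re X) \<le> 0"
proof -
  obtain a b where "eigenvalue X a" "eigenvalue X b" and ab: "a + b = trace X"
    using trace_det_eigenvalues .
  then have "Re a \<le> 0" "Re b \<le> 0"
    using assms by (auto simp: stable_matrices_def)
  then show ?thesis
    using arg_cong[OF ab, of Re] by (simp add: trace_def UNIV_2)
qed

lemma det_Re_ge_if_stable:
  assumes "X \<in> stable_matrices"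
  shows "- 2 * det (map_matrix Re X) \<le> (norm (map_matrix Im X))\<^sup>2"
proof -
  obtain a b where "eigenvalue X a" "eigenvalue X b"
    and ab: "a + b = trace X" "a * b = det X"
    using trace_det_eigenvalues .
  then have "Re a \<le> 0" "Re b \<le> 0"
    using assms by (auto simp: stable_matrices_def)
  then have "0 \<le> Re a * Re b" by (rule mult_nonpos_nonpos)
  \<comment> \<open>Trades the unknown product for the sum, which is the trace of the imaginary part
    of \<open>X\<close>.\<close>
  moreover have "4 * (Im a * Im b) \<le> (Im a + Im b)\<^sup>2"
    using zero_le_power2[of "Im a - Im b"] by (simp add: power2_eq_square algebra_simps)
  moreover have "Im a + Im b = Im (X$1$1) + Im (X$2$2)"
    using arg_cong[OF ab(1), of Im] by (simp add: trace_def UNIV_2)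
  moreover have "Re a * Re b - Im a * Im b =
      det (map_matrix Re X) - det (map_matrix Im X)"
    using arg_cong[OF ab(2), of Re] by (simp add: det_2)
  ultimately have "- 4 * det (map_matrix Re X) \<le>
      (Im (X$1$1) + Im (X$2$2))\<^sup>2 - 4 * det (map_matrix Im X)"
    by simp
  also have "\<dots> = 2 * (norm (map_matrix Im X))\<^sup>2
      - (Im (X$1$1) + Im (X$2$2))\<^sup>2 - 2 * (Im (X$1$2) - Im (X$2$1))\<^sup>2"
    by (simp add: norm_vec_def L2_set_def UNIV_2 det_2 power2_eq_square algebra_simps)
  also have "\<dots> \<le> 2 * (norm (map_matrix Im X))\<^sup>2"
    using zero_le_power2[of "Im (X$1$1) + Im (X$2$2)"]
      zero_le_power2[of "Im (X$1$2) - Im (X$2$1)"] by linarith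
  finally show ?thesis by simp
qed

lemma norm_cmat_diff_squared:
  "(norm (cmat A - X))\<^sup>2 = (norm (A - map_matrix Re X))\<^sup>2 + (norm (map_matrix Im X))\<^sup>2"
  by (simp add: norm_vec_def L2_set_def UNIV_2 cmod_power2)

lemma closer_real_stable:
  assumes X: "X \<in> stable_matrices"
  obtains B where "cmat B \<in> stable_matrices" "norm (cmat A - cmat B) \<le> norm (cmat A - X)"
proof -
  define P where "P = map_matrix Re X"
  define Q where "Q = map_matrix Im X"
  have X2: "(norm (cmat A - X))\<^sup>2 = (norm (A - P))\<^sup>2 + (norm Q)\<^sup>2"
    unfolding P_def Q_def by (rule norm_cmat_diff_squared)
  have B2: "(norm (cmat A - cmat B))\<^sup>2 = (norm (A - B))\<^sup>2" for B
    by (simp add: norm_vec_def L2_set_def UNIV_2 flip: of_real_diff)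
  have tr: "trace P \<le> 0"
    unfolding P_def by (rule trace_Re_nonpos_if_stable[OF X])
  have dQ: "- 2 * det P \<le> (norm Q)\<^sup>2"
    unfolding P_def Q_def by (rule det_Re_ge_if_stable[OF X])
  have "\<exists>B. trace B \<le> 0 \<and> det B \<ge> 0 \<and> (norm (A - B))\<^sup>2 \<le> (norm (A - P))\<^sup>2 + (norm Q)\<^sup>2"
  proof (cases "det P \<ge> 0")
    case True
    then show ?thesis using tr by (intro exI[of _ P]) simp
  next
    case False
    define J :: "real^2^2" where "J = vector [vector [0, 1], vector [-1, 0]]"
    \<comment> \<open>\<open>c\<close> is the linear coefficient of
      \<open>det (P + t *\<^sub>R J)\<close> in \<open>t\<close>, with roots \<open>t1\<close> and
      \<open>t2\<close>; \<open>m\<close> is the Frobenius inner product of \<open>A - P\<close> and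
      \<open>J\<close>.\<close>
    define c where "c = P$1$2 - P$2$1"
    define m where "m = (A - P)$1$2 - (A - P)$2$1"
    define r where "r = sqrt (c\<^sup>2 - 4 * det P)"
    define t1 where "t1 = (- c + r) / 2"
    define t2 where "t2 = (- c - r) / 2"
    have J: "J$1$1 = 0" "J$1$2 = 1" "J$2$1 = -1" "J$2$2 = 0"
      by (simp_all add: J_def)
    have "\<bar>c\<bar> < r"
      unfolding r_def by (rule real_less_rsqrt) (use False in simp)
    then have sgn: "0 < t1" "t2 < 0"
      by (auto simp: t1_def t2_def)
    have "r\<^sup>2 = c\<^sup>2 - 4 * det P"
      unfolding r_def using False zero_le_power2[of c] by (subst real_sqrt_pow2) linarith+
    then have t12: "t1 + t2 = - c" "t1 * t2 = det P"
      by (auto simp: t1_def t2_def field_simps power2_eq_square)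
    have tr_t: "trace (P + t *\<^sub>R J) = trace P" for t
      by (simp add: trace_def UNIV_2 J)
    have det_t: "det (P + t *\<^sub>R J) = (t - t1) * (t - t2)" for t
    proof -
      have "det (P + t *\<^sub>R J) = t * t + c * t + det P"
        by (simp add: det_2 J c_def algebra_simps)
      also have "\<dots> = t * t - (t1 + t2) * t + t1 * t2"
        by (simp add: t12)
      also have "\<dots> = (t - t1) * (t - t2)"
        by (simp add: algebra_simps)
      finally show ?thesis .
    qed
    have norm_t: "(norm (A - (P + t *\<^sub>R J)))\<^sup>2 = (norm (A - P))\<^sup>2 + 2 * (t * (t - m))" for t
      by (simp add: norm_vec_def L2_set_def UNIV_2 J m_def)
        (simp add: power2_eq_square algebra_simps)
    show ?thesis
    \<comment> \<open>The test decides which root is close enough: \<open>t1 - m \<le> - t2\<close>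
      in one case, \<open>t2 - m \<ge> - t1\<close> in the other. Either way the excess
      \<open>2 * (t * (t - m))\<close> is at most \<open>- 2 * det P\<close>, hence at most
      \<open>(norm Q)\<^sup>2\<close>.\<close>
    proof (cases "t1 + t2 \<le> m")
      case True
      then have "t1 * (t1 - m) \<le> t1 * - t2"
        using sgn by (intro mult_left_mono) auto
      then show ?thesis
        using tr dQ t12 by (intro exI[of _ "P + t1 *\<^sub>R J"]) (simp add: tr_t det_t norm_t)
    next
      case False
      then have "t2 * (t2 - m) \<le> t2 * - t1"
        using sgn by (intro mult_left_mono_neg) auto
      then show ?thesis
        using tr dQ t12
        by (intro exI[of _ "P + t2 *\<^sub>R J"]) (simp add: tr_t det_t norm_t mult.commute)
    qed
  qed
  then obtain B where "trace B \<le> 0" "det B \<ge> 0"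
    and "(norm (cmat A - cmat B))\<^sup>2 \<le> (norm (cmat A - X))\<^sup>2"
    unfolding X2 B2 by blast
  then show thesis
    by (intro that[of B] cmat_stable power2_le_imp_le[of "norm (cmat A - cmat B)"]) auto
qed

theorem proposition4p3:
  fixes A :: "real^2^2"
  shows "dist_stable_real A = dist_stable_complex A"
proof (rule antisym)
  obtain X where X: "X \<in> stable_matrices" "dist_stable_complex A = norm (cmat A - X)"
    using dist_stable_complex_min by blast
  obtain B where "cmat B \<in> stable_matrices" "norm (cmat A - cmat B) \<le> norm (cmat A - X)"
    using closer_real_stable[OF X(1)] .
  moreover from this have "dist_stable_real A \<le> norm (cmat A - cmat B)"
    using dist_stable_real_min by blast
  ultimately show "dist_stable_real A \<le> dist_stable_complex A"
    using X(2) by simp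
  show "dist_stable_complex A \<le> dist_stable_real A"
    using dist_stable_real_min[of A] dist_stable_complex_min[of A] by auto
qed

end
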